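(* Let $n\ge2$ and let $a_1,\ldots,a_n$ be nonnegative integers. Consider, for functions $w$ of the independent variables $y_1,\ldots,y_n$, the PDE $$ \sum_{i=1}^n y_i(y_1+\cdots+y_n-y_i)\partial_i^2w-2\sum_{1\le i<j\le n}y_iy_j\partial_i\partial_jw+\sum_{i=1}^n\bigl((a_1+\cdots+a_n)y_i-a_i(y_1+\cdots+y_n)\bigr)\partial_iw=0,\qquad(\ast) $$ where $\partial_i=\partial/\partial y_i$. Then the function $w(y_1,\ldots,y_n):=f_{a_1,\ldots,a_n}(y_1,\ldots,y_n)$ satisfies $(\ast)$. Similarly, for every permutation $\sigma$ of $1,\ldots,n$, the function $w(y_1,\ldots,y_n):=f_{a_{\sigma(1)},\ldots,a_{\sigma(n)}}(y_{\sigma(1)},\ldots,y_{\sigma(n)})$ satisfies $(\ast)$. Also, the function $w(y_1,\ldots,y_n):=(y_1+\cdots+y_n)^{a_1+\cdots+a_n+1}$ satisfies $(\ast)$.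
   Context: $(a)_k$ is the Pochhammer symbol: $(a)_0=1$ and $(a)_k=a(a+1)\cdots(a+k-1)$ for $k\ge1$. For nonnegative integers $b_1,\ldots,b_n$ and variables $x_1,\ldots,x_n$ (not constrained to sum to 1), with $s:=x_1+\cdots+x_n$, $$ f_{b_1,\ldots,b_n}(x_1,\ldots,x_n):=x_n^{b_n+1}\sum_{k_1=0}^{b_1}\cdots\sum_{k_{n-1}=0}^{b_{n-1}}\frac{(b_n+1)_{k_1+\cdots+k_{n-1}}}{k_1!\cdots k_{n-1}!}\,x_1^{k_1}\cdots x_{n-1}^{k_{n-1}}\,s^{\,b_1+\cdots+b_{n-1}-(k_1+\cdots+k_{n-1})}. $$ *)

theory Defs
  imports "HOL-Analysis.Analysis"
begin

text \<open>
  A tuple of \<open>n\<close> variables \<open>y\<^sub>1, \<dots>, y\<^sub>n\<close> is a function \<open>y :: nat \<Rightarrow> 'a\<close> of which only the values at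
  \<open>1, \<dots>, n\<close> matter. The class \<^class>\<open>real_normed_field\<close> covers both real and complex variables.
\<close>

definition pderiv_exists :: "nat \<Rightarrow> ((nat \<Rightarrow> 'a) \<Rightarrow> 'a) \<Rightarrow> (nat \<Rightarrow> 'a::real_normed_field) \<Rightarrow> bool"
  where "pderiv_exists i w y \<longleftrightarrow> (\<lambda>t. w (y(i := t))) field_differentiable (at (y i))"

definition partial :: "nat \<Rightarrow> ((nat \<Rightarrow> 'a) \<Rightarrow> 'a) \<Rightarrow> (nat \<Rightarrow> 'a::real_normed_field) \<Rightarrow> 'a"
  where "partial i w y = deriv (\<lambda>t. w (y(i := t))) (y i)"

definition f_poly :: "nat \<Rightarrow> (nat \<Rightarrow> nat) \<Rightarrow> (nat \<Rightarrow> 'a::real_normed_field) \<Rightarrow> 'a"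
  where "f_poly n b x =
    x n ^ (b n + 1) *
    (\<Sum>k \<in> (\<Pi>\<^sub>E i\<in>{1..n-1}. {0..b i}).
       pochhammer (of_nat (b n + 1)) (\<Sum>i=1..n-1. k i) / (\<Prod>i=1..n-1. fact (k i)) *
       (\<Prod>i=1..n-1. x i ^ k i) *
       (\<Sum>i=1..n. x i) ^ ((\<Sum>i=1..n-1. b i) - (\<Sum>i=1..n-1. k i)))"

text \<open>
  Since \<^const>\<open>deriv\<close> is unspecified where the derivative does not exist, being a solution includes
  the existence of all partial derivatives up to order two.
\<close>

definition satisfies_pde ::
    "nat \<Rightarrow> (nat \<Rightarrow> nat) \<Rightarrow> ((nat \<Rightarrow> 'a) \<Rightarrow> 'a::real_normed_field) \<Rightarrow> bool"
  where "satisfies_pde n a w \<longleftrightarrow> (\<forall>y.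
    (\<forall>i\<in>{1..n}. pderiv_exists i w y) \<and>
    (\<forall>i\<in>{1..n}. \<forall>j\<in>{1..n}. pderiv_exists i (partial j w) y) \<and>
    (\<Sum>i=1..n. y i * ((\<Sum>k=1..n. y k) - y i) * partial i (partial i w) y)
    - 2 * (\<Sum>i=1..n. \<Sum>j\<in>{i<..n}. y i * y j * partial i (partial j w) y)
    + (\<Sum>i=1..n. (of_nat (\<Sum>k=1..n. a k) * y i - of_nat (a i) * (\<Sum>k=1..n. y k)) * partial i w y)
    = 0)"

end

theory Submission
  imports Defs
begin

text \<open>
  Write \<open>s = y\<^sub>1 + \<dots> + y\<^sub>n\<close>, \<open>A = a\<^sub>1 + \<dots> + a\<^sub>n\<close> and let \<open>E = \<Sum> y\<^sub>i \<partial>\<^sub>i\<close> be the Euler operator. Collecting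
  the terms of the equation, its left-hand side is the operator
  \<open>s D - E (E - 1 - A)\<close> with \<open>D = \<Sum> (y\<^sub>i \<partial>\<^sub>i\<^sup>2 - a\<^sub>i \<partial>\<^sub>i)\<close>, applied to \<open>w\<close>. On a function that is
  homogeneous of degree \<open>A + 1\<close> the second part vanishes by Euler's theorem, so that such a
  function is a solution as soon as \<open>D w = 0\<close>. All functions in question are homogeneous of
  degree \<open>A + 1\<close>, and all are linear combinations of products \<open>y\<^sup>e s\<^sup>p\<close> of a monomial and a power of
  the sum (\<open>satisfies_pde_smon_sum\<close>).

  On a single product with \<open>|e| + p = A + 1\<close> one computes (\<open>smon_diagonal_operator\<close>)
  \<open>D (y\<^sup>e s\<^sup>p) = \<Sum> e\<^sub>i (e\<^sub>i - 1 - a\<^sub>i) y\<^bsup>e-i\<^esup> s\<^sup>p + p |e| y\<^sup>e s\<^bsup>p-1\<^esup>\<close>, where \<open>e-i\<close> has the \<open>i\<close>-th exponent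
  lowered by one. For \<open>s\<^bsup>A+1\<^esup>\<close> we have \<open>e = 0\<close> and both parts are zero.

  The function \<open>f\<close> is symmetric in all variables but the last, each taken together with its
  parameter, so after a permutation \<open>\<sigma>\<close> it depends only on the distinguished index \<open>m = \<sigma> n\<close> (\<open>f_poly_permuted_eq\<close>). Its terms are
  \<open>c\<^sub>k y\<^sup>e s\<^sup>p\<close> with \<open>e\<^sub>m = a\<^sub>m + 1\<close>, \<open>e\<^sub>i = k\<^sub>i \<le> a\<^sub>i\<close> for \<open>i \<noteq> m\<close>, and \<open>p = \<Sum> (a\<^sub>i - k\<^sub>i)\<close>. The index \<open>m\<close>
  contributes nothing to the first part of \<open>D\<close>. For \<open>i \<noteq> m\<close>, raising \<open>k\<^sub>i\<close> by one and using
  \<open>(k\<^sub>i + 1) c\<^bsub>k+i\<^esub> = |e| c\<^sub>k\<close> (\<open>f_coeff_Suc\<close>) turns the first part into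
  \<open>- \<Sum> (a\<^sub>i - k\<^sub>i) |e| c\<^sub>k y\<^sup>e s\<^bsup>p-1\<^esup>\<close>. There is no boundary contribution, because the factor
  \<open>a\<^sub>i - k\<^sub>i\<close> vanishes at \<open>k\<^sub>i = a\<^sub>i\<close>. Summed over \<open>i\<close>, this is the negative of the second part.
\<close>

section \<open>Products of a monomial and a power of the sum of the variables\<close>

text \<open>
  The exponent of the sum is kept separate from those of the variables: expanding the power would
  destroy the term-by-term cancellation on which the proof rests.
\<close>

definition smon :: "'i set \<Rightarrow> ('i \<Rightarrow> nat) \<Rightarrow> nat \<Rightarrow> ('i \<Rightarrow> 'a::real_normed_field) \<Rightarrow> 'a"
  where "smon I e p y = (\<Prod>i\<in>I. y i ^ e i) * (\<Sum>i\<in>I. y i) ^ p"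

text \<open>
  The first partial derivative, written as a combination of such products again. Truncated
  subtraction is harmless, as a truncated exponent is always multiplied by zero.
\<close>

definition smon_deriv ::
    "'i set \<Rightarrow> 'i \<Rightarrow> ('i \<Rightarrow> nat) \<Rightarrow> nat \<Rightarrow> ('i \<Rightarrow> 'a::real_normed_field) \<Rightarrow> 'a"
  where "smon_deriv I i e p y =
    of_nat (e i) * smon I (e(i := e i - 1)) p y + of_nat p * smon I e (p - 1) y"

text \<open>
  The iterated derivative \<open>\<partial>\<^sub>i \<partial>\<^sub>j\<close>: the outer index comes first.
\<close>

definition smon_deriv2 ::
    "'i set \<Rightarrow> 'i \<Rightarrow> 'i \<Rightarrow> ('i \<Rightarrow> nat) \<Rightarrow> nat \<Rightarrow> ('i \<Rightarrow> 'a::real_normed_field) \<Rightarrow> 'a"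
  where "smon_deriv2 I i j e p y =
    of_nat (e j) * smon_deriv I i (e(j := e j - 1)) p y + of_nat p * smon_deriv I i e (p - 1) y"

text \<open>
  Isolating one variable shows how the product depends on it alone.
\<close>

lemma smon_remove:
  assumes "finite I" "i \<in> I"
  shows "smon I e p y = y i ^ e i * (\<Prod>j\<in>I-{i}. y j ^ e j) * (y i + (\<Sum>j\<in>I-{i}. y j)) ^ p"
  using assms by (simp add: smon_def prod.remove sum.remove)

lemma smon_has_derivative:
  assumes "finite I" "i \<in> I"
  shows "((\<lambda>t. smon I e p (y(i := t))) has_field_derivative smon_deriv I i e p y) (at (y i))"
proof -
  define P where "P = (\<Prod>j\<in>I-{i}. y j ^ e j)"
  define S where "S = (\<Sum>j\<in>I-{i}. y j)"
  have *: "smon I e q (y(i := t)) = t ^ e i * P * (t + S) ^ q" for q t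
    unfolding smon_remove[OF assms] P_def S_def by simp
  have **: "smon I e q y = y i ^ e i * P * (y i + S) ^ q" for q
    using *[of q "y i"] by simp
  have ***: "smon I (e(i := e i - 1)) p y = y i ^ (e i - 1) * P * (y i + S) ^ p"
    unfolding smon_remove[OF assms] P_def S_def by simp
  show ?thesis
    unfolding * ** *** smon_deriv_def
    by (auto intro!: derivative_eq_intros simp: algebra_simps)
qed

lemma smon_deriv_has_derivative:
  assumes "finite I" "i \<in> I"
  shows "((\<lambda>t. smon_deriv I j e p (y(i := t))) has_field_derivative smon_deriv2 I i j e p y)
    (at (y i))"
  unfolding smon_deriv_def[of I j] smon_deriv2_def
  by (intro DERIV_add DERIV_cmult smon_has_derivative assms)

lemma smon_lower_exponent:
  assumes "finite I" "i \<in> I"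
  shows "y i * (of_nat (e i) * smon I (e(i := e i - 1)) p y) = of_nat (e i) * smon I e p y"
proof (cases "e i")
  case (Suc d)
  then show ?thesis unfolding smon_remove[OF assms] by (simp add: algebra_simps)
qed simp

lemma smon_lower_sum_power:
  "(\<Sum>i\<in>I. y i) * (of_nat p * smon I e (p - 1) y) = of_nat p * smon I e p y"
  by (cases p) (simp_all add: smon_def algebra_simps)

section \<open>Euler identities and the operator without mixed derivatives\<close>

text \<open>
  Multiplying \<open>\<partial>\<^sub>i\<close> by \<open>y\<^sub>i\<close> restores the lowered exponent, and the sum over \<open>i\<close> restores the lowered
  power of the sum; this is Euler's theorem for degree \<open>|e| + p\<close>.
\<close>

lemma smon_euler:
  assumes "finite I"
  shows "(\<Sum>i\<in>I. y i * smon_deriv I i e p y) = of_nat ((\<Sum>i\<in>I. e i) + p) * smon I e p y"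
proof -
  have "(\<Sum>i\<in>I. y i * smon_deriv I i e p y) =
      (\<Sum>i\<in>I. of_nat (e i) * smon I e p y + y i * (of_nat p * smon I e (p - 1) y))"
    unfolding smon_deriv_def
    by (intro sum.cong refl) (simp only: distrib_left smon_lower_exponent[OF assms])
  also have "\<dots> = of_nat (\<Sum>i\<in>I. e i) * smon I e p y + of_nat p * smon I e p y"
    unfolding sum.distrib sum_distrib_right[symmetric] smon_lower_sum_power by simp
  finally show ?thesis by (simp add: algebra_simps)
qed

text \<open>
  Each \<open>\<partial>\<^sub>j\<close> is homogeneous of degree \<open>d\<close>, so Euler's theorem applies a second time.
\<close>

lemma smon_euler2:
  fixes y :: "'i \<Rightarrow> 'a::real_normed_field"
  assumes "finite I" and d: "(\<Sum>i\<in>I. e i) + p = d + 1"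
  shows "(\<Sum>i\<in>I. \<Sum>j\<in>I. y i * y j * smon_deriv2 I i j e p y) =
    of_nat d * of_nat (d + 1) * smon I e p y"
proof -
  have inner: "(\<Sum>i\<in>I. y i * smon_deriv2 I i j e p y) = of_nat d * smon_deriv I j e p y"
    if "j \<in> I" for j
  proof -
    \<comment> \<open>The lowered product has degree \<open>d\<close> only if the exponent was positive; otherwise its factor is 0.\<close>
    have 1: "of_nat (e j) * (\<Sum>i\<in>I. y i * smon_deriv I i (e(j := e j - 1)) p y) =
        of_nat d * (of_nat (e j) * smon I (e(j := e j - 1)) p y)"
    proof (cases "e j")
      case (Suc r)
      have "(\<Sum>i\<in>I. (e(j := e j - 1)) i) + p = d"
        using d assms(1) that Suc by (simp add: sum.remove[of I j])
      then show ?thesis unfolding smon_euler[OF assms(1)] by simp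
    qed simp
    have 2: "of_nat p * (\<Sum>i\<in>I. y i * smon_deriv I i e (p - 1) y) =
        of_nat d * (of_nat p * smon I e (p - 1) y)"
    proof (cases p)
      case (Suc r)
      then have "(\<Sum>i\<in>I. e i) + (p - 1) = d" using d by simp
      then show ?thesis unfolding smon_euler[OF assms(1)] by simp
    qed simp
    have "(\<Sum>i\<in>I. y i * smon_deriv2 I i j e p y) =
        of_nat (e j) * (\<Sum>i\<in>I. y i * smon_deriv I i (e(j := e j - 1)) p y) +
        of_nat p * (\<Sum>i\<in>I. y i * smon_deriv I i e (p - 1) y)"
      unfolding smon_deriv2_def by (simp add: sum_distrib_left sum.distrib algebra_simps)
    also have "\<dots> = of_nat d * smon_deriv I j e p y"
      unfolding 1 2 smon_deriv_def[of I j] by (rule distrib_left[symmetric])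
    finally show ?thesis .
  qed
  have "(\<Sum>i\<in>I. \<Sum>j\<in>I. y i * y j * smon_deriv2 I i j e p y) =
      (\<Sum>j\<in>I. y j * (\<Sum>i\<in>I. y i * smon_deriv2 I i j e p y))"
    unfolding sum_distrib_left by (subst sum.swap) (simp add: algebra_simps)
  also have "\<dots> = of_nat d * (\<Sum>j\<in>I. y j * smon_deriv I j e p y)"
    by (simp add: inner sum_distrib_left algebra_simps)
  finally show ?thesis unfolding smon_euler[OF assms(1)] d by simp
qed

lemma smon_deriv2_commute:
  assumes "i \<noteq> j"
  shows "smon_deriv2 I i j e p y = smon_deriv2 I j i e p y"
  using assms unfolding smon_deriv2_def smon_deriv_def
  by (simp add: algebra_simps fun_upd_twist)

text \<open>
  In \<open>\<Sum> y\<^sub>i \<partial>\<^sub>i\<^sup>2\<close> the cross terms give \<open>2 p |e|\<close> and the second derivatives of \<open>s\<^sup>p\<close> give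
  \<open>p (p - 1)\<close>, both times \<open>y\<^sup>e s\<^bsup>p-1\<^esup>\<close>, while the first-order part subtracts \<open>p A\<close>. The degree condition
  makes the total coefficient \<open>p (2 |e| + p - 1 - A) = p |e|\<close>.
\<close>

lemma smon_diagonal_operator:
  fixes y :: "'i \<Rightarrow> 'a::real_normed_field"
  assumes "finite I" and deg: "(\<Sum>i\<in>I. e i) + p = (\<Sum>i\<in>I. a i) + 1"
  shows "(\<Sum>i\<in>I. y i * smon_deriv2 I i i e p y - of_nat (a i) * smon_deriv I i e p y) =
    (\<Sum>i\<in>I. of_nat (e i) * (of_nat (e i) - 1 - of_nat (a i)) * smon I (e(i := e i - 1)) p y)
    + of_nat p * of_nat (\<Sum>i\<in>I. e i) * smon I e (p - 1) y"
    (is "_ = ?D + _")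
proof -
  define T where "T = smon I e (p - 1) y"
  have summand: "y i * smon_deriv2 I i i e p y - of_nat (a i) * smon_deriv I i e p y =
      of_nat (e i) * (of_nat (e i) - 1 - of_nat (a i)) * smon I (e(i := e i - 1)) p y
      + (2 * of_nat (e i) - of_nat (a i)) * (of_nat p * T)
      + y i * (of_nat p * (of_nat (p - 1) * smon I e (p - 1 - 1) y))" if i: "i \<in> I" for i
  proof -
    have 1: "y i * (of_nat (e i) * smon I (e(i := e i - 1)) (p - 1) y) = of_nat (e i) * T"
      unfolding T_def by (rule smon_lower_exponent[OF assms(1) i])
    have 2: "y i * (of_nat (e i - 1) * smon I (e(i := e i - 1 - 1)) p y) =
        of_nat (e i - 1) * smon I (e(i := e i - 1)) p y"
      using smon_lower_exponent[OF assms(1) i, of y "e(i := e i - 1)" p] by simp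
    have "y i * smon_deriv2 I i i e p y =
        of_nat (e i) * (y i * (of_nat (e i - 1) * smon I (e(i := e i - 1 - 1)) p y))
        + 2 * of_nat p * (y i * (of_nat (e i) * smon I (e(i := e i - 1)) (p - 1) y))
        + y i * (of_nat p * (of_nat (p - 1) * smon I e (p - 1 - 1) y))"
      unfolding smon_deriv2_def smon_deriv_def by (simp add: algebra_simps)
    also have "\<dots> = of_nat (e i) * (of_nat (e i) - 1) * smon I (e(i := e i - 1)) p y
        + 2 * of_nat p * (of_nat (e i) * T)
        + y i * (of_nat p * (of_nat (p - 1) * smon I e (p - 1 - 1) y))"
      unfolding 1 2 by (cases "e i") auto
    finally show ?thesis
      unfolding smon_deriv_def T_def[symmetric] by (simp add: algebra_simps)
  qed
  have sum_last: "(\<Sum>i\<in>I. y i * (of_nat p * (of_nat (p - 1) * smon I e (p - 1 - 1) y))) =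
      of_nat p * (of_nat (p - 1) * T)"
  proof -
    have "(\<Sum>i\<in>I. y i * (of_nat p * (of_nat (p - 1) * smon I e (p - 1 - 1) y))) =
        of_nat p * ((\<Sum>i\<in>I. y i) * (of_nat (p - 1) * smon I e (p - 1 - 1) y))"
      unfolding sum_distrib_right[symmetric] by (rule mult.left_commute)
    then show ?thesis unfolding smon_lower_sum_power T_def .
  qed
  have "(\<Sum>i\<in>I. y i * smon_deriv2 I i i e p y - of_nat (a i) * smon_deriv I i e p y) =
      ?D + (2 * of_nat (\<Sum>i\<in>I. e i) - of_nat (\<Sum>i\<in>I. a i)) * (of_nat p * T)
      + of_nat p * (of_nat (p - 1) * T)"
    by (rule trans[OF sum.cong[OF refl summand]], assumption, unfold sum.distrib sum_last)
      (simp add: sum_subtractf sum_distrib_left[symmetric] sum_distrib_right[symmetric])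
  also have "\<dots> = ?D + of_nat p * of_nat (\<Sum>i\<in>I. e i) * T"
  proof (cases p)
    case (Suc r)
    have "of_nat (\<Sum>i\<in>I. a i) = (of_nat (\<Sum>i\<in>I. e i) + of_nat r :: 'a)"
      using deg Suc by (metis add_Suc_right add_right_cancel of_nat_add Suc_eq_plus1)
    then show ?thesis using Suc by (simp add: algebra_simps del: of_nat_sum)
  qed simp
  finally show ?thesis unfolding T_def .
qed

section \<open>Reduction of the differential equation to an identity of coefficients\<close>

text \<open>
  The equation lists each mixed derivative once, with factor 2, whereas the Euler identities
  produce the full double sum.
\<close>

lemma sum_offdiagonal_symmetric:
  fixes Q :: "nat \<Rightarrow> nat \<Rightarrow> 'a::comm_ring_1"
  assumes "\<And>i j. i \<noteq> j \<Longrightarrow> Q i j = Q j i"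
  shows "(\<Sum>i=1..n. \<Sum>j=1..n. Q i j) = (\<Sum>i=1..n. Q i i) + 2 * (\<Sum>i=1..n. \<Sum>j\<in>{i<..n}. Q i j)"
proof (induction n)
  case (Suc n)
  have [simp]: "{i<..Suc n} = insert (Suc n) {i<..n}" if "i \<in> {1..n}" for i
    using that by auto
  have "(\<Sum>i=1..n. \<Sum>j\<in>{i<..Suc n}. Q i j) = (\<Sum>i=1..n. Q i (Suc n)) + (\<Sum>i=1..n. \<Sum>j\<in>{i<..n}. Q i j)"
    by (simp add: sum.distrib)
  moreover have "(\<Sum>j=1..n. Q (Suc n) j) = (\<Sum>j=1..n. Q j (Suc n))"
    by (intro sum.cong refl assms) auto
  ultimately show ?case using Suc by (simp add: sum.distrib algebra_simps)
qed simp

text \<open>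
  By the Euler identities the degree condition leaves only \<open>s D w\<close> of the differential expression;
  the last hypothesis says that \<open>D w = 0\<close>.
\<close>

lemma satisfies_pde_smon_sum:
  fixes w :: "(nat \<Rightarrow> 'a::real_normed_field) \<Rightarrow> 'a"
  assumes w: "\<And>y. w y = (\<Sum>k\<in>K. c k * smon {1..n} (e k) (p k) y)"
    and deg: "\<And>k. k \<in> K \<Longrightarrow> (\<Sum>i=1..n. e k i) + p k = (\<Sum>i=1..n. a i) + 1"
    and cancel: "\<And>y. (\<Sum>k\<in>K. c k *
      ((\<Sum>i=1..n. of_nat (e k i) * (of_nat (e k i) - 1 - of_nat (a i)) *
          smon {1..n} ((e k)(i := e k i - 1)) (p k) y)
        + of_nat (p k) * of_nat (\<Sum>i=1..n. e k i) * smon {1..n} (e k) (p k - 1) y)) = 0"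
  shows "satisfies_pde n a w"
  unfolding satisfies_pde_def
proof (intro allI conjI ballI)
  let ?I = "{1..n}"
  have w': "w = (\<lambda>y. \<Sum>k\<in>K. c k * smon ?I (e k) (p k) y)" using w by blast
  have d1: "((\<lambda>t. w (y(i := t))) has_field_derivative
      (\<Sum>k\<in>K. c k * smon_deriv ?I i (e k) (p k) y)) (at (y i))" if "i \<in> ?I" for i y
    unfolding w' using that by (intro DERIV_sum DERIV_cmult smon_has_derivative) auto
  have p1: "partial i w = (\<lambda>y. \<Sum>k\<in>K. c k * smon_deriv ?I i (e k) (p k) y)" if "i \<in> ?I" for i
    unfolding partial_def using DERIV_imp_deriv[OF d1[OF that]] by blast
  have d2: "((\<lambda>t. partial j w (y(i := t))) has_field_derivative
      (\<Sum>k\<in>K. c k * smon_deriv2 ?I i j (e k) (p k) y)) (at (y i))"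
    if "i \<in> ?I" "j \<in> ?I" for i j y
    unfolding p1[OF that(2)] using that
    by (intro DERIV_sum DERIV_cmult smon_deriv_has_derivative) auto
  have p2: "partial i (partial j w) y = (\<Sum>k\<in>K. c k * smon_deriv2 ?I i j (e k) (p k) y)"
    if "i \<in> ?I" "j \<in> ?I" for i j y
    unfolding partial_def[of i] using DERIV_imp_deriv[OF d2[OF that]] .
  fix y :: "nat \<Rightarrow> 'a"
  show "pderiv_exists i w y" if "i \<in> ?I" for i
    unfolding pderiv_exists_def field_differentiable_def using d1[OF that] by blast
  show "pderiv_exists i (partial j w) y" if "i \<in> ?I" "j \<in> ?I" for i j
    unfolding pderiv_exists_def field_differentiable_def using d2[OF that] by blast
  define s where "s = (\<Sum>k=1..n. y k)"
  define A where "A = (\<Sum>k=1..n. a k)"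
  define W1 where "W1 i = partial i w y" for i
  define W2 where "W2 i j = partial i (partial j w) y" for i j
  have W1: "W1 i = (\<Sum>k\<in>K. c k * smon_deriv ?I i (e k) (p k) y)" if "i \<in> ?I" for i
    unfolding W1_def p1[OF that] ..
  note W2 = p2[of _ _ y, folded W2_def]
  have W2_sym: "W2 i j = W2 j i" if "i \<in> ?I" "j \<in> ?I" for i j
  proof (cases "i = j")
    case False
    show ?thesis unfolding W2[OF that] W2[OF that(2,1)] smon_deriv2_commute[OF False] ..
  qed simp
  \<comment> \<open>Cut off outside the index range, so that the symmetry holds for all pairs.\<close>
  define Q where "Q i j = (if i \<in> ?I \<and> j \<in> ?I then y i * y j * W2 i j else 0)" for i j
  have Q_sym: "Q i j = Q j i" for i j
    unfolding Q_def using W2_sym by (auto simp: mult.commute)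
  have Euler1: "(\<Sum>i=1..n. y i * W1 i) = of_nat (A + 1) * w y"
  proof -
    have "(\<Sum>i=1..n. y i * W1 i) =
        (\<Sum>k\<in>K. c k * (\<Sum>i=1..n. y i * smon_deriv ?I i (e k) (p k) y))"
      unfolding sum_distrib_left by (subst sum.swap) (simp add: W1 sum_distrib_left mult.left_commute)
    also have "\<dots> = (\<Sum>k\<in>K. of_nat (A + 1) * (c k * smon ?I (e k) (p k) y))"
      by (intro sum.cong refl) (simp only: smon_euler[OF finite_atLeastAtMost] deg A_def mult.left_commute)
    finally show ?thesis by (simp add: w sum_distrib_left)
  qed
  have Euler2: "(\<Sum>i=1..n. \<Sum>j=1..n. Q i j) = of_nat A * of_nat (A + 1) * w y"
  proof -
    have "(\<Sum>i=1..n. \<Sum>j=1..n. Q i j) =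
        (\<Sum>i=1..n. \<Sum>j=1..n. \<Sum>k\<in>K. c k * (y i * y j * smon_deriv2 ?I i j (e k) (p k) y))"
      unfolding Q_def by (intro sum.cong refl) (simp add: W2 sum_distrib_left mult.left_commute)
    also have "\<dots> = (\<Sum>k\<in>K. c k * (\<Sum>i=1..n. \<Sum>j=1..n. y i * y j * smon_deriv2 ?I i j (e k) (p k) y))"
      unfolding sum_distrib_left by (simp only: sum.swap[of _ K])
    also have "\<dots> = (\<Sum>k\<in>K. of_nat A * of_nat (A + 1) * (c k * smon ?I (e k) (p k) y))"
      by (intro sum.cong refl)
        (simp only: smon_euler2[OF finite_atLeastAtMost deg, folded A_def] mult.left_commute)
    finally show ?thesis by (simp add: w sum_distrib_left)
  qed
  have diag: "(\<Sum>i=1..n. y i * W2 i i - of_nat (a i) * W1 i) = 0"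
  proof -
    have "(\<Sum>i=1..n. y i * W2 i i - of_nat (a i) * W1 i) =
        (\<Sum>i=1..n. \<Sum>k\<in>K. c k * (y i * smon_deriv2 ?I i i (e k) (p k) y
          - of_nat (a i) * smon_deriv ?I i (e k) (p k) y))"
      by (intro sum.cong refl)
        (simp add: W1 W2 sum_distrib_left sum_subtractf right_diff_distrib mult.left_commute)
    also have "\<dots> = (\<Sum>k\<in>K. c k * (\<Sum>i=1..n. y i * smon_deriv2 ?I i i (e k) (p k) y
          - of_nat (a i) * smon_deriv ?I i (e k) (p k) y))"
      unfolding sum_distrib_left by (rule sum.swap)
    also have "\<dots> = 0"
      unfolding cancel[of y, symmetric]
      by (intro sum.cong refl arg_cong2[of _ _ _ _ "(*)"] smon_diagonal_operator deg) auto
    finally show ?thesis .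
  qed
  have offdiag: "(\<Sum>i=1..n. \<Sum>j\<in>{i<..n}. y i * y j * W2 i j) = (\<Sum>i=1..n. \<Sum>j\<in>{i<..n}. Q i j)"
    unfolding Q_def by (intro sum.cong refl) auto
  have "(\<Sum>i=1..n. y i * (s - y i) * W2 i i) + (\<Sum>i=1..n. (of_nat A * y i - of_nat (a i) * s) * W1 i) =
      (\<Sum>i=1..n. s * (y i * W2 i i - of_nat (a i) * W1 i) + of_nat A * (y i * W1 i) - Q i i)"
    unfolding sum.distrib[symmetric] Q_def by (intro sum.cong refl) (simp add: algebra_simps)
  also have "\<dots> = of_nat A * (of_nat (A + 1) * w y) - (\<Sum>i=1..n. Q i i)"
    unfolding sum_subtractf sum.distrib sum_distrib_left[symmetric] diag[unfolded sum_subtractf] Euler1 by simp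
  also have "\<dots> = 2 * (\<Sum>i=1..n. \<Sum>j\<in>{i<..n}. Q i j)"
    using Euler2 sum_offdiagonal_symmetric[of Q n, OF Q_sym] by (simp add: algebra_simps)
  finally show "(\<Sum>i=1..n. y i * ((\<Sum>k=1..n. y k) - y i) * partial i (partial i w) y)
    - 2 * (\<Sum>i=1..n. \<Sum>j\<in>{i<..n}. y i * y j * partial i (partial j w) y)
    + (\<Sum>i=1..n. (of_nat (\<Sum>k=1..n. a k) * y i - of_nat (a i) * (\<Sum>k=1..n. y k)) * partial i w y)
    = 0"
    unfolding W1_def[symmetric] W2_def[symmetric] s_def[symmetric] A_def[symmetric] offdiag
    by (simp add: algebra_simps)
qed

section \<open>Cancellation in the multiple sum\<close>

text \<open>
  Shifting one index of a sum over a box by one. No boundary terms arise, since \<open>g\<close> vanishes on the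
  lower face of the box and \<open>h\<close> on the upper one.
\<close>

lemma sum_PiE_shift:
  fixes g :: "('i \<Rightarrow> nat) \<Rightarrow> 'a::comm_monoid_add"
  assumes "finite J" "i \<in> J"
    and "\<And>k. k i = 0 \<Longrightarrow> g k = 0"
    and "\<And>k. k i = b i \<Longrightarrow> h k = 0"
    and shift: "\<And>k. k \<in> (\<Pi>\<^sub>E j\<in>J. {0..b j}) \<Longrightarrow> k i < b i \<Longrightarrow> g (k(i := Suc (k i))) = h k"
  shows "(\<Sum>k\<in>(\<Pi>\<^sub>E j\<in>J. {0..b j}). g k) = (\<Sum>k\<in>(\<Pi>\<^sub>E j\<in>J. {0..b j}). h k)"
proof -
  let ?K = "\<Pi>\<^sub>E j\<in>J. {0..b j}"
  have fin: "finite ?K" using assms(1) by (intro finite_PiE) auto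
  have "sum g ?K = sum g {k\<in>?K. k i \<noteq> 0}"
    using fin assms(3) by (intro sum.mono_neutral_right) auto
  also have "\<dots> = sum h {k\<in>?K. k i \<noteq> b i}"
  proof (rule sum.reindex_bij_witness[of _ "\<lambda>k. k(i := Suc (k i))" "\<lambda>k. k(i := k i - 1)"])
    fix k assume k: "k \<in> {k\<in>?K. k i \<noteq> 0}"
    then have "k i \<le> b i" "k i \<noteq> 0" using assms(2) by (auto simp: PiE_iff)
    then show "k(i := k i - 1) \<in> {k\<in>?K. k i \<noteq> b i}"
      using k assms(2) by (auto simp: PiE_iff extensional_def)
    then show "h (k(i := k i - 1)) = g k"
      using shift[of "k(i := k i - 1)"] \<open>k i \<le> b i\<close> \<open>k i \<noteq> 0\<close> by simp
  next
    fix k assume k: "k \<in> {k\<in>?K. k i \<noteq> b i}"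
    then have "k i \<le> b i" using assms(2) by (auto simp: PiE_iff)
    then show "k(i := Suc (k i)) \<in> {k\<in>?K. k i \<noteq> 0}"
      using k assms(2) by (auto simp: PiE_iff extensional_def)
  qed auto
  also have "\<dots> = sum h ?K"
    using fin assms(4) by (intro sum.mono_neutral_left) auto
  finally show ?thesis .
qed

definition f_coeff :: "'i set \<Rightarrow> nat \<Rightarrow> ('i \<Rightarrow> nat) \<Rightarrow> 'a::real_normed_field"
  where "f_coeff J \<beta> k = pochhammer (of_nat \<beta>) (\<Sum>j\<in>J. k j) / (\<Prod>j\<in>J. fact (k j))"

text \<open>
  For \<open>\<beta> = a\<^sub>m + 1\<close> the factor \<open>\<beta> + |k|\<close> on the right is the total degree \<open>|e|\<close> of the monomial that
  \<open>f_coeff\<close> multiplies in \<open>f\<close>; this is why the two parts of the operator can cancel.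
\<close>

lemma f_coeff_Suc:
  assumes "finite J" "i \<in> J"
  shows "f_coeff J \<beta> (k(i := Suc (k i))) * of_nat (Suc (k i)) =
    (f_coeff J \<beta> k * of_nat (\<beta> + (\<Sum>j\<in>J. k j)) :: 'a::real_normed_field)"
proof -
  have 1: "(\<Sum>j\<in>J. (k(i := Suc (k i))) j) = Suc (\<Sum>j\<in>J. k j)"
    using assms by (simp add: sum.remove)
  have 2: "(\<Prod>j\<in>J. fact ((k(i := Suc (k i))) j)) = (of_nat (Suc (k i)) * (\<Prod>j\<in>J. fact (k j)) :: 'a)"
    using assms by (simp add: prod.remove algebra_simps)
  have cancel: "P * q / (u * F) * u = P / F * q" if "u \<noteq> 0" for P q u F :: 'a
    using that by simp
  show ?thesis
    unfolding f_coeff_def 1 2 pochhammer_Suc of_nat_add by (rule cancel[OF of_nat_neq_0])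
qed

text \<open>
  The permutation maps the summation indices \<open>1, \<dots>, n-1\<close> bijectively onto \<open>J\<close>, so it merely renames
  the summation variables, and all that remains of it is the distinguished index.
\<close>

lemma f_poly_permuted_eq:
  fixes y :: "nat \<Rightarrow> 'a::real_normed_field"
  assumes "n \<ge> 1" and \<sigma>: "\<sigma> permutes {1..n}"
  defines "m \<equiv> \<sigma> n" and "J \<equiv> {1..n} - {\<sigma> n}"
  shows "f_poly n (\<lambda>i. a (\<sigma> i)) (\<lambda>i. y (\<sigma> i)) =
    (\<Sum>k\<in>(\<Pi>\<^sub>E j\<in>J. {0..a j}). f_coeff J (a m + 1) k *
      smon {1..n} (k(m := a m + 1)) ((\<Sum>j\<in>J. a j) - (\<Sum>j\<in>J. k j)) y)"
proof -
  let ?I = "{1..n-1}"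
  have m: "m \<in> {1..n}" using assms(1) permutes_in_image[OF \<sigma>, of n] by (simp add: m_def)
  have I: "?I = {1..n} - {n}" using assms(1) by auto
  have inj: "inj_on \<sigma> A" for A using permutes_inj[OF \<sigma>] by (rule inj_on_subset) simp
  have bij: "bij_betw \<sigma> ?I J"
    unfolding bij_betw_def I J_def using inj permutes_image[OF \<sigma>]
    by (simp add: image_set_diff[OF permutes_inj[OF \<sigma>]])
  have bij': "bij_betw \<sigma> {1..n} {1..n}" by (rule permutes_imp_bij[OF \<sigma>])
  have sumJ: "(\<Sum>i\<in>?I. f (\<sigma> i)) = sum f J" for f :: "nat \<Rightarrow> nat"
    by (rule sum.reindex_bij_betw[OF bij])
  have prodJ: "(\<Prod>i\<in>?I. f (\<sigma> i)) = prod f J" for f :: "nat \<Rightarrow> 'a"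
    by (rule prod.reindex_bij_betw[OF bij])
  have sum1: "(\<Sum>i=1..n. y (\<sigma> i)) = (\<Sum>i=1..n. y i)"
    by (rule sum.reindex_bij_betw[OF bij'])
  have inv1: "inv \<sigma> (\<sigma> i) = i" and inv2: "\<sigma> (inv \<sigma> i) = i" for i
    using permutes_inverses[OF \<sigma>] by auto
  have inJ: "\<sigma> i \<in> J \<longleftrightarrow> i \<in> ?I" for i
    using bij permutes_inj[OF \<sigma>] by (metis bij_betw_def inj_image_mem_iff)
  have summand: "pochhammer (of_nat (a m + 1)) (\<Sum>i\<in>?I. k (\<sigma> i)) / (\<Prod>i\<in>?I. fact (k (\<sigma> i))) *
       (\<Prod>i\<in>?I. y (\<sigma> i) ^ k (\<sigma> i)) *
       (\<Sum>i=1..n. y (\<sigma> i)) ^ ((\<Sum>i\<in>?I. a (\<sigma> i)) - (\<Sum>i\<in>?I. k (\<sigma> i))) * y m ^ (a m + 1) =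
      f_coeff J (a m + 1) k *
      smon {1..n} (k(m := a m + 1)) ((\<Sum>j\<in>J. a j) - (\<Sum>j\<in>J. k j)) y" for k
  proof -
    have "(\<Prod>j\<in>{1..n}. y j ^ (k(m := a m + 1)) j) = y m ^ (a m + 1) * (\<Prod>j\<in>J. y j ^ k j)"
      using m unfolding J_def m_def[symmetric] by (simp add: prod.remove)
    then show ?thesis
      unfolding smon_def f_coeff_def sumJ sum1
        prodJ[of "\<lambda>j. fact (k j)"] prodJ[of "\<lambda>j. y j ^ k j"]
      by (simp only: mult.assoc mult.commute mult.left_commute)
  qed
  have "f_poly n (\<lambda>i. a (\<sigma> i)) (\<lambda>i. y (\<sigma> i)) =
    (\<Sum>k\<in>(\<Pi>\<^sub>E i\<in>?I. {0..a (\<sigma> i)}). pochhammer (of_nat (a m + 1)) (\<Sum>i\<in>?I. k i) /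
       (\<Prod>i\<in>?I. fact (k i)) * (\<Prod>i\<in>?I. y (\<sigma> i) ^ k i) *
       (\<Sum>i=1..n. y (\<sigma> i)) ^ ((\<Sum>i\<in>?I. a (\<sigma> i)) - (\<Sum>i\<in>?I. k i)) * y m ^ (a m + 1))"
    unfolding f_poly_def m_def[symmetric] sum_distrib_left
    by (intro sum.cong refl) (rule mult.commute)
  also have "\<dots> = (\<Sum>k\<in>(\<Pi>\<^sub>E j\<in>J. {0..a j}).
       pochhammer (of_nat (a m + 1)) (\<Sum>i\<in>?I. k (\<sigma> i)) / (\<Prod>i\<in>?I. fact (k (\<sigma> i))) *
       (\<Prod>i\<in>?I. y (\<sigma> i) ^ k (\<sigma> i)) *
       (\<Sum>i=1..n. y (\<sigma> i)) ^ ((\<Sum>i\<in>?I. a (\<sigma> i)) - (\<Sum>i\<in>?I. k (\<sigma> i))) * y m ^ (a m + 1))"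
  proof (rule sum.reindex_bij_witness[of _ "\<lambda>k. k \<circ> \<sigma>" "\<lambda>k. k \<circ> inv \<sigma>"])
    fix k assume k: "k \<in> (\<Pi>\<^sub>E i\<in>?I. {0..a (\<sigma> i)})"
    have inI: "inv \<sigma> j \<in> ?I \<longleftrightarrow> j \<in> J" for j using inJ[of "inv \<sigma> j"] by (simp add: inv2)
    have "k (inv \<sigma> j) \<le> a j" if "j \<in> J" for j
      using PiE_mem[OF k, of "inv \<sigma> j"] that inI[of j] by (simp add: inv2)
    moreover have "k (inv \<sigma> j) = undefined" if "j \<notin> J" for j
      using PiE_arb[OF k, of "inv \<sigma> j"] that inI[of j] by blast
    ultimately show "k \<circ> inv \<sigma> \<in> (\<Pi>\<^sub>E j\<in>J. {0..a j})"
      by (simp add: PiE_iff extensional_def)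
  next
    fix k assume k: "k \<in> (\<Pi>\<^sub>E j\<in>J. {0..a j})"
    then show "k \<circ> \<sigma> \<in> (\<Pi>\<^sub>E i\<in>?I. {0..a (\<sigma> i)})"
      using inJ by (auto simp: PiE_iff extensional_def)
  qed (auto simp: fun_eq_iff inv1 inv2)
  finally show ?thesis unfolding summand .
qed

text \<open>
  The cancellation holds for each index \<open>i \<in> J\<close> separately after a shift of \<open>k\<^sub>i\<close>, with weight
  \<open>a\<^sub>i - k\<^sub>i\<close>; these weights add up to the exponent \<open>p\<close>.
\<close>

lemma satisfies_pde_f_poly_permuted:
  assumes "n \<ge> 1" and \<sigma>: "\<sigma> permutes {1..n}"
  shows "satisfies_pde n a (\<lambda>y :: nat \<Rightarrow> 'a::real_normed_field.
    f_poly n (\<lambda>i. a (\<sigma> i)) (\<lambda>i. y (\<sigma> i)))"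
proof -
  define m where "m = \<sigma> n"
  define J where "J = {1..n} - {m}"
  define K where "K = (\<Pi>\<^sub>E j\<in>J. {0..a j})"
  define c :: "(nat \<Rightarrow> nat) \<Rightarrow> 'a" where "c = f_coeff J (a m + 1)"
  define e where "e k = k(m := a m + 1)" for k
  define p where "p k = (\<Sum>j\<in>J. a j) - (\<Sum>j\<in>J. k j)" for k
  have m: "m \<in> {1..n}" using assms(1) permutes_in_image[OF \<sigma>, of n] by (simp add: m_def)
  have J: "finite J" "m \<notin> J" "{1..n} = insert m J" using m by (auto simp: J_def)
  have le: "k j \<le> a j" if "k \<in> K" "j \<in> J" for k j using that by (auto simp: K_def PiE_iff)
  have sum_e: "(\<Sum>i=1..n. e k i) = a m + 1 + (\<Sum>j\<in>J. k j)" for k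
  proof -
    have "sum (e k) J = sum k J" using J by (intro sum.cong refl) (auto simp: e_def)
    then show ?thesis unfolding J(3) using J by (simp add: e_def)
  qed
  have eq: "f_poly n (\<lambda>i. a (\<sigma> i)) (\<lambda>i. y (\<sigma> i)) =
      (\<Sum>k\<in>K. c k * smon {1..n} (e k) (p k) y)" for y :: "nat \<Rightarrow> 'a"
    unfolding f_poly_permuted_eq[OF assms] K_def c_def e_def p_def J_def m_def ..
  have deg: "(\<Sum>i=1..n. e k i) + p k = (\<Sum>i=1..n. a i) + 1" if k: "k \<in> K" for k
  proof -
    have "(\<Sum>j\<in>J. k j) \<le> (\<Sum>j\<in>J. a j)" using le[OF k] by (rule sum_mono)
    moreover have "(\<Sum>i=1..n. a i) = a m + (\<Sum>j\<in>J. a j)" unfolding J(3) using J by simp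
    ultimately show ?thesis unfolding sum_e p_def by simp
  qed
  show ?thesis
  proof (rule satisfies_pde_smon_sum[where K = K and c = c and e = e and p = p, OF eq deg])
    fix y :: "nat \<Rightarrow> 'a"
    let ?S = "smon {1..n}"
    have shift: "(\<Sum>k\<in>K. c k * (of_nat (k i) * (of_nat (k i) - 1 - of_nat (a i)) *
          ?S ((e k)(i := k i - 1)) (p k) y)) =
        (\<Sum>k\<in>K. - (of_nat (a i - k i) * (c k * of_nat (\<Sum>i=1..n. e k i) * ?S (e k) (p k - 1) y)))"
      if i: "i \<in> J" for i
      unfolding K_def
    proof (rule sum_PiE_shift[OF J(1) i], goal_cases)
      case (3 k)
      let ?k = "k(i := Suc (k i))"
      have p: "p ?k = p k - 1" using J(1) i by (simp add: p_def sum.remove)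
      have e: "(e ?k)(i := ?k i - 1) = e k" using J(2) i by (auto simp: e_def fun_eq_iff)
      have c: "c ?k * of_nat (Suc (k i)) = c k * of_nat (\<Sum>i=1..n. e k i)"
        unfolding c_def sum_e by (rule f_coeff_Suc[OF J(1) i])
      have a: "of_nat (?k i) - 1 - of_nat (a i) = (- of_nat (a i - k i) :: 'a)"
        using 3(2) by (simp add: of_nat_diff)
      have "c ?k * (of_nat (?k i) * (of_nat (?k i) - 1 - of_nat (a i)) * ?S ((e ?k)(i := ?k i - 1)) (p ?k) y) =
          - (of_nat (a i - k i) * (c ?k * of_nat (Suc (k i)) * ?S (e k) (p k - 1) y))"
        unfolding a e p by (simp add: mult.assoc mult.left_commute del: of_nat_Suc)
      then show ?case unfolding c .
    qed auto
    have "(\<Sum>k\<in>K. c k * ((\<Sum>i=1..n. of_nat (e k i) * (of_nat (e k i) - 1 - of_nat (a i)) *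
            ?S ((e k)(i := e k i - 1)) (p k) y))) =
        (\<Sum>k\<in>K. \<Sum>i\<in>J. c k * (of_nat (k i) * (of_nat (k i) - 1 - of_nat (a i)) *
            ?S ((e k)(i := k i - 1)) (p k) y))"
    proof (intro sum.cong refl)
      fix k
      \<comment> \<open>The index \<open>m\<close> drops out: \<open>e\<^sub>m - 1 - a\<^sub>m = 0\<close>.\<close>
      have "e k m = a m + 1" "\<And>i. i \<in> J \<Longrightarrow> e k i = k i" using J(2) by (auto simp: e_def)
      then show "c k * ((\<Sum>i=1..n. of_nat (e k i) * (of_nat (e k i) - 1 - of_nat (a i)) *
            ?S ((e k)(i := e k i - 1)) (p k) y)) =
          (\<Sum>i\<in>J. c k * (of_nat (k i) * (of_nat (k i) - 1 - of_nat (a i)) *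
            ?S ((e k)(i := k i - 1)) (p k) y))"
        unfolding sum_distrib_left[symmetric] sum.insert[OF J(1,2), folded J(3)] by simp
    qed
    also have "\<dots> = (\<Sum>k\<in>K. - (\<Sum>i\<in>J. of_nat (a i - k i) *
        (c k * of_nat (\<Sum>i=1..n. e k i) * ?S (e k) (p k - 1) y)))"
      unfolding sum.swap[of _ J] sum_negf[symmetric] by (rule sum.cong[OF refl shift])
    also have "\<dots> = - (\<Sum>k\<in>K. c k * (of_nat (p k) * of_nat (\<Sum>i=1..n. e k i) * ?S (e k) (p k - 1) y))"
      unfolding sum_negf neg_equal_iff_equal
    proof (rule sum.cong[OF refl])
      fix k assume k: "k \<in> K"
      have "p k = (\<Sum>i\<in>J. a i - k i)"
        unfolding p_def using le[OF k] by (rule sum_subtractf_nat[symmetric])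
      then show "(\<Sum>i\<in>J. of_nat (a i - k i) *
          (c k * of_nat (\<Sum>i=1..n. e k i) * ?S (e k) (p k - 1) y)) =
        c k * (of_nat (p k) * of_nat (\<Sum>i=1..n. e k i) * ?S (e k) (p k - 1) y)"
        unfolding sum_distrib_right[symmetric] of_nat_sum[symmetric]
        by (simp only: mult.assoc mult.left_commute)
    qed
    finally show "(\<Sum>k\<in>K. c k *
        ((\<Sum>i=1..n. of_nat (e k i) * (of_nat (e k i) - 1 - of_nat (a i)) *
            ?S ((e k)(i := e k i - 1)) (p k) y)
          + of_nat (p k) * of_nat (\<Sum>i=1..n. e k i) * ?S (e k) (p k - 1) y)) = 0"
      by (simp only: distrib_left sum.distrib) simp
  qed
qed

text \<open>
  A single product with all exponents of the variables zero.
\<close>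

lemma satisfies_pde_sum_power:
  "satisfies_pde n a (\<lambda>y :: nat \<Rightarrow> 'a::real_normed_field.
    (\<Sum>i=1..n. y i) ^ ((\<Sum>i=1..n. a i) + 1))"
proof (rule satisfies_pde_smon_sum[where K = "{()}" and c = "\<lambda>_. 1" and e = "\<lambda>_ _. 0"
      and p = "\<lambda>_. (\<Sum>i=1..n. a i) + 1"])
qed (simp_all add: smon_def)

theorem theorem11p3:
  fixes n :: nat and a :: "nat \<Rightarrow> nat"
  assumes "n \<ge> 2"
  shows "satisfies_pde n a (\<lambda>y :: nat \<Rightarrow> 'a::real_normed_field. f_poly n a y)
    \<and> (\<forall>\<sigma>. \<sigma> permutes {1..n} \<longrightarrow>
         satisfies_pde n a (\<lambda>y :: nat \<Rightarrow> 'a. f_poly n (\<lambda>i. a (\<sigma> i)) (\<lambda>i. y (\<sigma> i))))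
    \<and> satisfies_pde n a (\<lambda>y :: nat \<Rightarrow> 'a. (\<Sum>i=1..n. y i) ^ ((\<Sum>i=1..n. a i) + 1))"
proof (intro conjI allI impI)
  have "n \<ge> 1" using assms by simp
  note permuted = satisfies_pde_f_poly_permuted[OF this, where 'a = 'a]
  show "satisfies_pde n a (\<lambda>y :: nat \<Rightarrow> 'a. f_poly n a y)"
    using permuted[OF permutes_id] by simp
  show "satisfies_pde n a (\<lambda>y :: nat \<Rightarrow> 'a. f_poly n (\<lambda>i. a (\<sigma> i)) (\<lambda>i. y (\<sigma> i)))"
    if "\<sigma> permutes {1..n}" for \<sigma>
    using that by (rule permuted)
qed (rule satisfies_pde_sum_power)

end
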